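(* Let $r,d\ge 1$ be integers, $N=r+d$, and let $H=\begin{bmatrix}A&B\\C&D\end{bmatrix}\in M_N(\pm1)$ be a Hadamard matrix with $A\in M_r(\pm1)$ and $D\in M_d(\pm1)$. Then $D$ is an almost Hadamard sign pattern (AHP) if any one of the following conditions holds: (1) $A$ is invertible, and $r\in\{1,2,3\}$. (2) $A$ is Hadamard, and $N>r(r-1)^2$. (3) $A$ is invertible, and $N>\frac{r^2}{4}\left(r+\sqrt{r^2+8}\right)^2$.
   Context: $M_n(\pm1)$ denotes the set of $n\times n$ matrices with entries in $\{-1,1\}$. A Hadamard matrix is a matrix in $M_n(\pm1)$ whose rows are pairwise orthogonal. The coordinate $1$-norm of a matrix is $\|M\|_1=\sum_{i,j}|M_{ij}|$. A matrix $K\in M_n(\mathbb R)$ is called almost Hadamard (AHM) if $U=K/\sqrt n$ is orthogonal and is a local maximum of the $1$-norm on the orthogonal group $O(n)$. A matrix $S\in M_n(\pm1)$ is called an almost Hadamard sign pattern (AHP) if there exists an almost Hadamard matrix $K\in M_n(\mathbb R)$ such that $S_{ij}=\mathrm{sgn}(K_{ij})$ for all $i,j$. *)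

theory Defs
  imports "HOL-Analysis.Analysis"
begin

text \<open>Matrices are indexed by finite types, so the size of a square matrix over the index type
  \<open>'n\<close> is \<open>CARD('n)\<close>; in \<open>real^'n^'m\<close> the rows are indexed by \<open>'m\<close> and the columns by \<open>'n\<close>.\<close>

definition sign_matrix :: "real^'n^'m \<Rightarrow> bool" where
  "sign_matrix M \<longleftrightarrow> (\<forall>i j. M $ i $ j \<in> {-1, 1})"

definition hadamard :: "real^'n^'n \<Rightarrow> bool" where
  "hadamard M \<longleftrightarrow> sign_matrix M \<and> (\<forall>i j. i \<noteq> j \<longrightarrow> orthogonal (row i M) (row j M))"

definition one_norm :: "real^'n^'m \<Rightarrow> real" where
  "one_norm M = (\<Sum>i\<in>UNIV. \<Sum>j\<in>UNIV. \<bar>M $ i $ j\<bar>)"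

text \<open>Local maxima are not required to be strict.\<close>

definition local_max_on :: "('a::topological_space \<Rightarrow> real) \<Rightarrow> 'a set \<Rightarrow> 'a \<Rightarrow> bool" where
  "local_max_on f S x \<longleftrightarrow> x \<in> S \<and> (\<forall>\<^sub>F y in at x within S. f y \<le> f x)"

definition almost_hadamard :: "real^'n^'n \<Rightarrow> bool" where
  "almost_hadamard K \<longleftrightarrow>
     local_max_on one_norm {V. orthogonal_matrix V} ((1 / sqrt (real CARD('n))) *\<^sub>R K)"

definition almost_hadamard_pattern :: "real^'n^'n \<Rightarrow> bool" where
  "almost_hadamard_pattern S \<longleftrightarrow>
     sign_matrix S \<and> (\<exists>K. almost_hadamard K \<and> (\<forall>i j. S $ i $ j = sgn (K $ i $ j)))"

definition block_matrix ::
  "real^'r^'r \<Rightarrow> real^'d^'r \<Rightarrow> real^'r^'d \<Rightarrow> real^'d^'d \<Rightarrow> real^('r + 'd)^('r + 'd)" where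
  "block_matrix A B C D = (\<chi> i j.
     case i of
       Inl a \<Rightarrow> (case j of Inl b \<Rightarrow> A $ a $ b | Inr b \<Rightarrow> B $ a $ b)
     | Inr a \<Rightarrow> (case j of Inl b \<Rightarrow> C $ a $ b | Inr b \<Rightarrow> D $ a $ b))"

end

theory Submission
  imports Defs
begin

text \<open>
  Write \<open>s = sqrt N\<close> and take a polar form \<open>A = V P\<close> with \<open>V\<close> orthogonal and \<open>P\<close> symmetric positive
  semidefinite. The matrix \<open>H / s\<close> is orthogonal, and closing it up by feeding the first \<open>r\<close> outputs
  through \<open>- V\<^sup>T\<close> back into the first \<open>r\<close> inputs yields an orthogonal matrix
  \<open>U = (D - C (s V + A)\<^sup>-\<^sup>1 B) / s\<close> of order \<open>d\<close>. A computation with inner products shows that \<open>U\<^sup>T D\<close>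
  is symmetric positive semidefinite, so \<open>U\<close> is an orthogonal polar factor of \<open>D\<close>.

  If moreover the correction \<open>C (s V + A)\<^sup>-\<^sup>1 B\<close> has all entries of modulus less than 1, then \<open>U\<close> has the
  signs of \<open>D\<close>, and near \<open>U\<close> the 1-norm is the linear functional \<open>X \<mapsto> trace (D\<^sup>T X)\<close>. A symmetric
  positive semidefinite \<open>T\<close> satisfies \<open>trace (T Q) \<le> trace T\<close> for all orthogonal \<open>Q\<close>
  (\<open>trace_psd_mult_orthogonal_le\<close>), hence \<open>U\<close> maximises this functional on the orthogonal group and
  \<open>D\<close> is an almost Hadamard sign pattern (\<open>almost_hadamard_patternI\<close>).

  As the rows of \<open>C\<close> and the columns of \<open>B\<close> have length \<open>sqrt r\<close>, the Cauchy-Schwarz inequality bounds the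
  correction by \<open>r / (s + m)\<close> when \<open>P \<ge> m\<close>, so that \<open>r < sqrt N + m\<close> suffices
  (\<open>hadamard_complement_pattern\<close>). What remains is to find \<open>V\<close>, \<open>P\<close> and \<open>m\<close>. If \<open>A\<^sup>T A = r I\<close>, which
  covers Hadamard matrices and invertible sign matrices of order at most 2, then \<open>P = sqrt r I\<close> and
  \<open>m = sqrt r\<close>. For an invertible sign matrix of order 3 the eigenvalues of \<open>A\<^sup>T A\<close> are 1, 4, 4, so
  \<open>m = 1\<close>; this settles \<open>N > 4\<close>, and for \<open>N = 4\<close> the block \<open>D\<close> has order 1. In general \<open>m = 0\<close> works as
  soon as \<open>N > r\<^sup>2\<close>; the polar form is then obtained by maximising \<open>trace (V\<^sup>T A)\<close> over the compact
  orthogonal group (\<open>polar_decomposition\<close>).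
\<close>

section \<open>Trace maximisation over the orthogonal group\<close>

lemma inner_matrix_vector_mult:
  fixes M :: "real^'n^'m"
  shows "(M *v x) \<bullet> y = x \<bullet> (transpose M *v y)"
  by (metis dot_lmul_matrix inner_commute transpose_matrix_vector)

lemma orthogonal_matrixI_inner:
  fixes U :: "real^'n^'n"
  assumes "\<And>x y. (U *v x) \<bullet> (U *v y) = x \<bullet> y"
  shows "orthogonal_matrix U"
proof -
  have "orthogonal_transformation ((*v) U)"
    using assms by (simp add: orthogonal_transformation_def)
  then show ?thesis
    by (simp add: orthogonal_transformation_matrix)
qed

lemma trace_transpose: "trace (transpose M) = trace M"
  by (simp add: trace_def transpose_def)

lemma trace_alt_inner:
  fixes M :: "real^'n^'n"
  shows "trace M = (\<Sum>j\<in>UNIV. axis j 1 \<bullet> (M *v axis j 1))"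
  by (simp add: trace_def inner_axis' matrix_vector_mult_basis column_def)

lemma trace_conjugate_nonneg:
  fixes T :: "real^'n^'n"
  assumes "\<And>x. 0 \<le> x \<bullet> (T *v x)"
  shows "0 \<le> trace (transpose R ** T ** R)"
proof -
  have "axis j 1 \<bullet> ((transpose R ** T ** R) *v axis j 1)
      = (R *v axis j 1) \<bullet> (T *v (R *v axis j 1))" for j
    by (simp add: inner_matrix_vector_mult matrix_vector_mul_assoc matrix_mul_assoc
        del: transpose_matrix_vector)
  then show ?thesis
    using assms by (simp add: trace_alt_inner sum_nonneg)
qed

lemma matrix_diff_ldistrib:
  fixes X :: "'a::ring_1^'n^'m"
  shows "X ** (Y - Z) = X ** Y - X ** Z"
  by (simp add: matrix_matrix_mult_def vec_eq_iff right_diff_distrib sum_subtractf)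

lemma matrix_diff_rdistrib:
  fixes X :: "'a::ring_1^'n^'m"
  shows "(X - Y) ** Z = X ** Z - Y ** Z"
  by (simp add: matrix_matrix_mult_def vec_eq_iff left_diff_distrib sum_subtractf)

lemma transpose_diff: "transpose (X - Y) = transpose X - transpose Y"
  by (simp add: transpose_def vec_eq_iff)

text \<open>Twice the difference of the two traces is the trace of \<open>(1 - Q)\<^sup>T T (1 - Q)\<close>.\<close>
lemma trace_psd_mult_orthogonal_le:
  fixes T Q :: "real^'n^'n"
  assumes sym: "transpose T = T" and psd: "\<And>x. 0 \<le> x \<bullet> (T *v x)"
    and Q: "orthogonal_matrix Q"
  shows "trace (T ** Q) \<le> trace T"
proof -
  let ?R = "mat 1 - Q"
  have eq: "transpose ?R ** T ** ?R
      = T - T ** Q - transpose Q ** T + transpose Q ** (T ** Q)"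
    by (simp add: transpose_diff matrix_diff_ldistrib matrix_diff_rdistrib matrix_mul_assoc)
  have "trace (transpose Q ** T) = trace (T ** Q)"
    by (metis sym matrix_transpose_mul trace_transpose)
  moreover have "trace (transpose Q ** (T ** Q)) = trace T"
    using Q trace_mul_sym[of "transpose Q" "T ** Q"]
    by (simp add: orthogonal_matrix_def flip: matrix_mul_assoc)
  ultimately have "trace (transpose ?R ** T ** ?R) = 2 * (trace T - trace (T ** Q))"
    by (simp add: eq trace_sub trace_add)
  with trace_conjugate_nonneg[OF psd, of ?R] show ?thesis by simp
qed

definition householder :: "real^'n \<Rightarrow> real^'n^'n" where
  "householder u = (\<chi> i j. (if i = j then 1 else 0) - 2 * u $ i * u $ j / (u \<bullet> u))"

lemma householder_mult_vec:
  "householder u *v x = x - (2 * (u \<bullet> x) / (u \<bullet> u)) *\<^sub>R u"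
proof -
  have "(householder u *v x) $ i = (x - (2 * (u \<bullet> x) / (u \<bullet> u)) *\<^sub>R u) $ i" for i
  proof -
    have "(householder u *v x) $ i
        = (\<Sum>j\<in>UNIV. (if i = j then x $ j else 0) - 2 * u $ i / (u \<bullet> u) * (u $ j * x $ j))"
      unfolding matrix_vector_mult_def householder_def
      by (auto simp: algebra_simps intro!: sum.cong)
    also have "\<dots> = x $ i - 2 * u $ i / (u \<bullet> u) * (\<Sum>j\<in>UNIV. u $ j * x $ j)"
      by (simp add: sum_subtractf sum_distrib_left)
    finally show ?thesis by (simp add: inner_vec_def)
  qed
  then show ?thesis by (simp add: vec_eq_iff)
qed

lemma orthogonal_householder:
  assumes "u \<noteq> 0"
  shows "orthogonal_matrix (householder u)"
proof -
  have "householder u *v (householder u *v x) = x" for x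
    using assms by (simp add: householder_mult_vec inner_diff_right)
  then have "householder u ** householder u = mat 1"
    by (simp add: matrix_eq matrix_vector_mul_assoc)
  moreover have "transpose (householder u) = householder u"
    by (auto simp: householder_def transpose_def vec_eq_iff)
  ultimately show ?thesis by (simp add: orthogonal_matrix)
qed

lemma trace_householder_mult:
  fixes S :: "real^'n^'n"
  shows "trace (householder u ** S) = trace S - 2 * (u \<bullet> (S *v u)) / (u \<bullet> u)"
proof -
  have "trace (householder u ** S) = (\<Sum>j\<in>UNIV. axis j 1 \<bullet> (S *v axis j 1)
      - 2 * (u \<bullet> (S *v axis j 1)) / (u \<bullet> u) * (axis j 1 \<bullet> u))"
    by (simp add: trace_alt_inner householder_mult_vec inner_diff_right
        flip: matrix_vector_mul_assoc)
  also have "\<dots> = trace S - 2 / (u \<bullet> u) * (\<Sum>j\<in>UNIV. (u \<bullet> (S *v axis j 1)) * (axis j 1 \<bullet> u))"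
    by (simp add: trace_alt_inner sum_subtractf sum_distrib_left mult.assoc)
  also have "(\<Sum>j\<in>UNIV. (u \<bullet> (S *v axis j 1)) * (axis j 1 \<bullet> u)) = (transpose S *v u) \<bullet> u"
    unfolding inner_vec_def[of "transpose S *v u"]
  proof (rule sum.cong[OF refl])
    fix j
    show "(u \<bullet> (S *v axis j 1)) * (axis j 1 \<bullet> u) = (transpose S *v u) $ j \<bullet> u $ j"
      using inner_matrix_vector_mult[of "transpose S" u "axis j 1"]
      by (simp add: inner_axis inner_axis' del: transpose_matrix_vector)
  qed
  also have "(transpose S *v u) \<bullet> u = u \<bullet> (S *v u)"
    using inner_matrix_vector_mult[of "transpose S" u u] by simp
  finally show ?thesis by simp
qed

text \<open>The converse of \<open>trace_psd_mult_orthogonal_le\<close>, from two kinds of test matrices. One reflection changes the trace by a negative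
  multiple of a value of the quadratic form, which gives semidefiniteness. A product of two
  reflections in nearby directions is a small rotation of a plane, and its first order effect on the
  trace is the antisymmetric part of \<open>S\<close> in that plane.\<close>
lemma trace_maximal_imp_symmetric_psd:
  fixes S :: "real^'n^'n"
  assumes max: "\<And>Q. orthogonal_matrix Q \<Longrightarrow> trace (Q ** S) \<le> trace S"
  shows "transpose S = S" and "0 \<le> x \<bullet> (S *v x)"
proof -
  show psd: "0 \<le> x \<bullet> (S *v x)" for x
  proof (cases "x = 0")
    case False
    then have "x \<bullet> x > 0" by simp
    then show ?thesis
      using max[OF orthogonal_householder[OF False]]
      by (simp add: trace_householder_mult zero_le_divide_iff del: inner_gt_zero_iff)
  qed simp
  have le: "S $ i $ j \<le> S $ j $ i" if "i \<noteq> j" for i j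
  proof (rule ccontr)
    define y z :: "real^'n" where "y = axis i 1" and "z = axis j 1"
    define a where "a = S $ i $ i + S $ j $ j"
    define b where "b = S $ i $ j - S $ j $ i"
    have yz: "y \<bullet> y = 1" "z \<bullet> z = 1" "y \<bullet> z = 0" "z \<bullet> y = 0" "y \<noteq> 0"
      using that by (auto simp: y_def z_def inner_axis_axis)
    have S: "y \<bullet> (S *v y) = S $ i $ i" "z \<bullet> (S *v z) = S $ j $ j"
       "y \<bullet> (S *v z) = S $ i $ j" "z \<bullet> (S *v y) = S $ j $ i"
      by (simp_all add: y_def z_def inner_axis' matrix_vector_mult_basis column_def)
    have ineq: "0 \<le> t\<^sup>2 * a - t * b" for t
    proof -
      \<comment> \<open>The reflections in \<open>x\<close> and \<open>y\<close> compose to a rotation by an angle of order \<open>t\<close>.\<close>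
      define x where "x = y + t *\<^sub>R z"
      have xx: "x \<bullet> x = 1 + t\<^sup>2" and xy: "y \<bullet> x = 1"  "x \<bullet> y = 1"
        by (simp_all add: x_def inner_simps yz power2_eq_square)
      have "x \<noteq> 0" using xy by force
      let ?Q = "householder x ** householder y"
      have "trace (?Q ** S) = trace (householder x ** (householder y ** S))"
        by (simp add: matrix_mul_assoc)
      also have "\<dots> = trace S - 2 * (y \<bullet> (S *v y))
          - 2 * ((x \<bullet> (S *v x) - 2 * (y \<bullet> (S *v x))) / (1 + t\<^sup>2))"
        by (simp add: trace_householder_mult householder_mult_vec inner_diff_right xx xy yz
            flip: matrix_vector_mul_assoc)
      finally have "0 \<le> y \<bullet> (S *v y) + (x \<bullet> (S *v x) - 2 * (y \<bullet> (S *v x))) / (1 + t\<^sup>2)"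
        using max[OF orthogonal_matrix_mul[OF orthogonal_householder[OF \<open>x \<noteq> 0\<close>]
              orthogonal_householder[OF \<open>y \<noteq> 0\<close>]]] by linarith
      moreover have "1 + t\<^sup>2 > 0" by (simp add: add_pos_nonneg)
      ultimately have "0 \<le> (1 + t\<^sup>2) * (y \<bullet> (S *v y)) + (x \<bullet> (S *v x) - 2 * (y \<bullet> (S *v x)))"
        by (metis (no_types, lifting) distrib_left mult_nonneg_nonneg less_imp_le
            nonzero_mult_div_cancel_left order_less_irrefl times_divide_eq_right)
      also have "\<dots> = t\<^sup>2 * a - t * b"
        by (simp add: x_def matrix_vector_right_distrib matrix_vector_mult_scaleR inner_simps S
            a_def b_def power2_eq_square algebra_simps)
      finally show ?thesis .
    qed
    assume "\<not> S $ i $ j \<le> S $ j $ i"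
    then have b: "b > 0" by (simp add: b_def)
    have a: "a \<ge> 0" using psd[of y] psd[of z] by (simp add: a_def S)
    \<comment> \<open>Small enough that the linear term outweighs the quadratic one, also when \<open>a = 0\<close>.\<close>
    define t where "t = b / (a + 1)"
    have "t > 0" using a b by (simp add: t_def)
    with ineq[of t] have "b \<le> t * a" by (simp add: power2_eq_square mult.assoc)
    also have "\<dots> < b" using a b by (simp add: t_def field_simps)
    finally show False by simp
  qed
  have "S $ i $ j = S $ j $ i" for i j
    using le[of i j] le[of j i] by (cases "i = j") auto
  then show "transpose S = S" by (simp add: transpose_def vec_eq_iff)
qed

lemma compact_orthogonal_matrices: "compact {Q :: real^'n^'n. orthogonal_matrix Q}"
proof -
  have "{Q :: real^'n^'n. orthogonal_matrix Q}
      = (\<Inter>i. \<Inter>j. {Q. (transpose Q ** Q) $ i $ j = (mat 1 :: real^'n^'n) $ i $ j})"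
    by (auto simp: orthogonal_matrix vec_eq_iff)
  moreover have "closed {Q :: real^'n^'n. (transpose Q ** Q) $ i $ j = (mat 1 :: real^'n^'n) $ i $ j}"
    for i j
    unfolding matrix_matrix_mult_def transpose_def
    by (simp, intro closed_Collect_eq continuous_intros)
  ultimately have "closed {Q :: real^'n^'n. orthogonal_matrix Q}"
    by (metis (no_types, lifting) closed_INT)
  moreover have "norm Q \<le> real CARD('n)" if "orthogonal_matrix Q" for Q :: "real^'n^'n"
  proof -
    have "norm (Q $ i) = 1" for i
      using that by (simp add: orthogonal_matrix_orthonormal_rows row_def vec_lambda_eta)
    then show ?thesis
      using L2_set_le_sum[of UNIV "\<lambda>i. norm (Q $ i)"]
      by (simp add: norm_vec_def)
  qed
  ultimately show ?thesis
    by (auto simp: compact_eq_bounded_closed bounded_iff)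
qed

text \<open>Existence of a polar form without spectral theory: a maximiser of \<open>trace (Q\<^sup>T A)\<close> over the
  orthogonal group is an orthogonal factor. Right multiplication permutes that group, so
  \<open>trace_maximal_imp_symmetric_psd\<close> applies to \<open>V\<^sup>T A\<close>.\<close>
proposition polar_decomposition:
  fixes A :: "real^'n^'n"
  obtains V where "orthogonal_matrix V" "transpose (transpose V ** A) = transpose V ** A"
    "\<And>x. 0 \<le> x \<bullet> (transpose V ** A *v x)"
proof -
  have "continuous_on {Q :: real^'n^'n. orthogonal_matrix Q} (\<lambda>Q. trace (transpose Q ** A))"
    unfolding trace_def matrix_matrix_mult_def transpose_def
    by (simp, intro continuous_intros)
  moreover have "{Q :: real^'n^'n. orthogonal_matrix Q} \<noteq> {}"
    using orthogonal_matrix_id by blast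
  ultimately obtain V where V: "orthogonal_matrix V"
    and max: "\<And>Q :: real^'n^'n. orthogonal_matrix Q \<Longrightarrow> trace (transpose Q ** A) \<le> trace (transpose V ** A)"
    using continuous_attains_sup[OF compact_orthogonal_matrices, of "\<lambda>Q. trace (transpose Q ** A)"]
    by auto
  have "trace (Q ** (transpose V ** A)) \<le> trace (transpose V ** A)" if "orthogonal_matrix Q" for Q
    using max[OF orthogonal_matrix_mul[OF V, of "transpose Q"]] that
    by (simp add: matrix_transpose_mul matrix_mul_assoc)
  from trace_maximal_imp_symmetric_psd[OF this] V that show thesis by blast
qed

section \<open>A sufficient criterion for sign patterns\<close>

lemma trace_transpose_mult:
  "trace (transpose D ** V) = (\<Sum>i\<in>UNIV. \<Sum>j\<in>UNIV. D $ i $ j * V $ i $ j)"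
  unfolding trace_def matrix_matrix_mult_def transpose_def
  by (simp, rule sum.swap)

text \<open>The last two assumptions say that \<open>U\<^sup>T D\<close> is symmetric positive semidefinite. Where the signs of
  \<open>V\<close> agree with \<open>D\<close>, which by strictness is a neighbourhood of \<open>U\<close>, the 1-norm of \<open>V\<close> is the linear
  functional \<open>trace (D\<^sup>T V)\<close>, and this is maximal at \<open>U\<close> on the whole orthogonal group.\<close>
lemma almost_hadamard_patternI:
  fixes D U :: "real^'n^'n"
  assumes U: "orthogonal_matrix U" and D: "sign_matrix D"
    and sgn: "\<And>i j. sgn (U $ i $ j) = D $ i $ j"
    and sym: "\<And>x y. (U *v x) \<bullet> (D *v y) = (U *v y) \<bullet> (D *v x)"
    and psd: "\<And>x. 0 \<le> (U *v x) \<bullet> (D *v x)"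
  shows "almost_hadamard_pattern D"
proof -
  define T where "T = transpose U ** D"
  have T: "x \<bullet> (T *v y) = (U *v x) \<bullet> (D *v y)" for x y
    by (simp add: T_def inner_matrix_vector_mult matrix_vector_mul_assoc del: transpose_matrix_vector)
  have Tsym: "transpose T = T"
  proof -
    have "x \<bullet> (transpose T *v y) = x \<bullet> (T *v y)" for x y
      by (metis T sym inner_matrix_vector_mult inner_commute)
    then show ?thesis
      by (metis matrix_eq vector_eq_ldot)
  qed
  have le: "trace (transpose D ** V) \<le> trace (transpose D ** U)" if V: "orthogonal_matrix V" for V
  proof -
    have DU: "transpose D ** U = T"
      using Tsym by (simp add: T_def matrix_transpose_mul)
    have UU: "U ** transpose U = mat 1"
      using U by (simp add: orthogonal_matrix_def)
    have "transpose D ** V = (transpose D ** (U ** transpose U)) ** V" by (simp add: UU)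
    also have "\<dots> = T ** (transpose U ** V)"
      by (simp add: matrix_mul_assoc flip: DU)
    finally show ?thesis
      using trace_psd_mult_orthogonal_le[OF Tsym, of "transpose U ** V"] psd U V
      by (simp add: T DU orthogonal_matrix_mul)
  qed
  have norm_eq: "one_norm V = trace (transpose D ** V)" if "\<And>i j. 0 < D $ i $ j * V $ i $ j" for V
  proof -
    have "\<bar>V $ i $ j\<bar> = D $ i $ j * V $ i $ j" for i j
      using that[of i j] D[unfolded sign_matrix_def, rule_format, of i j]
      by (auto simp: abs_if)
    then show ?thesis by (simp add: one_norm_def trace_transpose_mult)
  qed
  have pos: "0 < D $ i $ j * U $ i $ j" for i j
  proof -
    have "D $ i $ j \<noteq> 0"
      using D[unfolded sign_matrix_def, rule_format, of i j] by auto
    then show ?thesis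
      using sgn[of i j] by (metis abs_sgn mult.commute sgn_0_0 zero_less_abs_iff)
  qed
  have "\<forall>\<^sub>F V in at U within {V. orthogonal_matrix V}. \<forall>i j. 0 < D $ i $ j * V $ i $ j"
    by (intro eventually_all_finite order_tendstoD(1)[OF tendsto_mult[OF tendsto_const
          tendsto_vec_nth[OF tendsto_vec_nth[OF tendsto_ident_at]]] pos])
  moreover have "\<forall>\<^sub>F V in at U within {V. orthogonal_matrix V}. orthogonal_matrix V"
    by (simp add: eventually_at_filter)
  ultimately have "\<forall>\<^sub>F V in at U within {V. orthogonal_matrix V}. one_norm V \<le> one_norm U"
    by eventually_elim (simp add: norm_eq pos le)
  then have "local_max_on one_norm {V. orthogonal_matrix V} U"
    by (simp add: local_max_on_def U)
  then have "almost_hadamard (sqrt (real CARD('n)) *\<^sub>R U)"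
    by (simp add: almost_hadamard_def)
  moreover have "D $ i $ j = sgn ((sqrt (real CARD('n)) *\<^sub>R U) $ i $ j)" for i j
    by (simp add: sgn_mult sgn)
  ultimately show ?thesis
    using D unfolding almost_hadamard_pattern_def by blast
qed

section \<open>Blocks of Hadamard matrices\<close>

text \<open>Orthogonality of the rows gives \<open>H H\<^sup>T = n I\<close>; one-sided inverses of square matrices are
  two-sided, so the columns are orthogonal too.\<close>
lemma hadamard_gram:
  fixes H :: "real^'n^'n"
  assumes "hadamard H"
  shows "transpose H ** H = real CARD('n) *\<^sub>R mat 1"
proof -
  let ?n = "real CARD('n)"
  have diag: "row i H \<bullet> row i H = ?n" for i
  proof -
    have "H $ i $ j * H $ i $ j = 1" for j
      using assms unfolding hadamard_def sign_matrix_def by (metis (no_types) insertE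
          emptyE mult_1 mult_minus1 minus_minus)
    then show ?thesis by (simp add: inner_vec_def row_def)
  qed
  have "H ** transpose H = ?n *\<^sub>R mat 1"
    using assms diag
    by (auto simp: matrix_mult_transpose_dot_row vec_eq_iff mat_def hadamard_def orthogonal_def)
  then have "H ** ((1 / ?n) *\<^sub>R transpose H) = mat 1"
    by (simp add: matrix_scalar_ac flip: scalar_matrix_assoc)
  then have "((1 / ?n) *\<^sub>R transpose H) ** H = mat 1"
    by (simp add: matrix_left_right_inverse)
  then have "(1 / ?n) *\<^sub>R (transpose H ** H) = mat 1"
    by (simp add: scalar_matrix_assoc)
  from arg_cong[OF this, of "\<lambda>M. ?n *\<^sub>R M"] show ?thesis by simp
qed

definition block_vec :: "real^'r \<Rightarrow> real^'d \<Rightarrow> real^('r + 'd)" where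
  "block_vec p q = (\<chi> i. case i of Inl a \<Rightarrow> p $ a | Inr b \<Rightarrow> q $ b)"

lemma sum_UNIV_Plus:
  "(\<Sum>i\<in>(UNIV :: ('a::finite + 'b::finite) set). f i) = (\<Sum>a\<in>UNIV. f (Inl a)) + (\<Sum>b\<in>UNIV. f (Inr b))"
  by (simp add: sum.Plus o_def flip: UNIV_Plus_UNIV)

lemma inner_block_vec: "block_vec p q \<bullet> block_vec p' q' = p \<bullet> p' + q \<bullet> q'"
  by (simp add: inner_vec_def block_vec_def sum_UNIV_Plus)

lemma block_matrix_mult_vec:
  "block_matrix A B C D *v block_vec p q = block_vec (A *v p + B *v q) (C *v p + D *v q)"
  by (auto simp: vec_eq_iff matrix_vector_mult_def block_matrix_def block_vec_def sum_UNIV_Plus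
      split: sum.split)

lemma hadamard_block_inner:
  fixes A :: "real^'r^'r" and D :: "real^'d^'d"
  assumes "hadamard (block_matrix A B C D)"
  shows "(A *v p + B *v q) \<bullet> (A *v p' + B *v q') + (C *v p + D *v q) \<bullet> (C *v p' + D *v q')
    = real (CARD('r) + CARD('d)) * (p \<bullet> p' + q \<bullet> q')"
proof -
  let ?H = "block_matrix A B C D"
  have "(?H *v block_vec p q) \<bullet> (?H *v block_vec p' q')
      = block_vec p q \<bullet> ((transpose ?H ** ?H) *v block_vec p' q')"
    by (simp add: inner_matrix_vector_mult matrix_vector_mul_assoc del: transpose_matrix_vector)
  then show ?thesis
    by (simp add: hadamard_gram[OF assms] block_matrix_mult_vec inner_block_vec
        flip: scaleR_matrix_vector_assoc)
qed

lemma sign_matrix_blocks: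
  assumes "sign_matrix (block_matrix A B C D)"
  shows "sign_matrix A" "sign_matrix B" "sign_matrix C" "sign_matrix D"
proof -
  have *: "block_matrix A B C D $ a $ b \<in> {-1, 1}" for a b
    using assms by (simp add: sign_matrix_def)
  have "A $ i $ j \<in> {-1, 1} \<and> B $ i $ k \<in> {-1, 1} \<and> C $ l $ j \<in> {-1, 1} \<and> D $ l $ k \<in> {-1, 1}"
    for i j k l
    using *[of "Inl i" "Inl j"] *[of "Inl i" "Inr k"] *[of "Inr l" "Inl j"] *[of "Inr l" "Inr k"]
    by (simp add: block_matrix_def)
  then show "sign_matrix A" "sign_matrix B" "sign_matrix C" "sign_matrix D"
    by (simp_all add: sign_matrix_def)
qed

lemma norm_sign_vec:
  fixes x :: "real^'n"
  assumes "\<And>i. x $ i \<in> {-1, 1}"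
  shows "norm x = sqrt (real CARD('n))"
proof -
  have "x $ i * x $ i = 1" for i
    using assms[of i] by auto
  then show ?thesis by (simp add: norm_eq_sqrt_inner inner_vec_def)
qed

text \<open>The heart of the argument. All properties of \<open>U\<close> come from the identity \<open>gram\<close> below, applied to
  vectors \<open>(- Y q, q)\<close>, where \<open>Y = (s V + A)\<^sup>-\<^sup>1 B\<close> is chosen so that \<open>H\<close> sends \<open>(- Y q, q)\<close> to
  \<open>s (V Y q, U q)\<close>: as \<open>H / s\<close> and \<open>V\<close> preserve lengths, so does \<open>U\<close>.\<close>
proposition hadamard_complement_pattern:
  fixes A V P :: "real^'r^'r" and B :: "real^'d^'r" and C :: "real^'r^'d" and D :: "real^'d^'d"
  assumes H: "hadamard (block_matrix A B C D)"
    and V: "orthogonal_matrix V" and A: "A = V ** P" and P: "transpose P = P"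
    and m: "0 \<le> m" "\<And>x. m * (x \<bullet> x) \<le> x \<bullet> (P *v x)"
    and bound: "real CARD('r) < sqrt (real (CARD('r) + CARD('d))) + m"
  shows "almost_hadamard_pattern D"
proof -
  define N where "N = real (CARD('r) + CARD('d))"
  define s where "s = sqrt N"
  have "N > 0" by (simp add: N_def add_pos_pos)
  then have s: "s > 0" "s * s = N" by (simp_all add: s_def)
  have gram: "(A *v p + B *v q) \<bullet> (A *v p' + B *v q') + (C *v p + D *v q) \<bullet> (C *v p' + D *v q')
    = N * (p \<bullet> p' + q \<bullet> q')" for p q p' q'
    unfolding N_def by (rule hadamard_block_inner[OF H])
  have V_inner: "(V *v x) \<bullet> (V *v y) = x \<bullet> y" for x y
    using V by (simp add: inner_matrix_vector_mult matrix_vector_mul_assoc orthogonal_matrix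
        del: transpose_matrix_vector)
  have P_inner: "(P *v x) \<bullet> y = x \<bullet> (P *v y)" for x y
    using inner_matrix_vector_mult[of P x y] P by simp
  have P_nonneg: "0 \<le> x \<bullet> (P *v x)" for x
    using m(1) m(2)[of x] inner_ge_zero[of x] by (meson mult_nonneg_nonneg order_trans)

  \<comment> \<open>Since \<open>s V + A = V K\<close>, inverting \<open>K\<close> is enough, and \<open>K \<ge> s > 0\<close>.\<close>
  define K where "K = s *\<^sub>R mat 1 + P"
  have K: "K *v x = s *\<^sub>R x + P *v x" for x
    by (simp add: K_def matrix_vector_mult_add_rdistrib flip: scaleR_matrix_vector_assoc)
  have "x = 0" if "K *v x = 0" for x
  proof -
    have "0 = x \<bullet> (K *v x)" by (simp add: that)
    also have "\<dots> = s * (x \<bullet> x) + x \<bullet> (P *v x)" by (simp add: K inner_simps)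
    finally have "s * (x \<bullet> x) \<le> 0" using P_nonneg[of x] by linarith
    with s(1) have "x \<bullet> x \<le> 0" by (simp add: mult_le_0_iff)
    then show ?thesis by (metis inner_gt_zero_iff not_less)
  qed
  then obtain L where "L ** K = mat 1"
    using matrix_left_invertible_ker[of K] by auto
  then have L: "K ** L = mat 1" by (simp add: matrix_left_right_inverse)
  define Y where "Y = L ** transpose V ** B"
  define U where "U = (1 / s) *\<^sub>R (D - C ** Y)"
  have B: "B *v q = V *v (s *\<^sub>R (Y *v q) + P *v (Y *v q))" for q
  proof -
    have "V *v (K *v (Y *v q)) = (V ** (K ** L) ** transpose V ** B) *v q"
      by (simp add: Y_def matrix_vector_mul_assoc matrix_mul_assoc)
    also have "\<dots> = B *v q"
      using V by (simp add: L orthogonal_matrix_def)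
    finally show ?thesis by (simp add: K)
  qed
  have A_vec: "A *v x = V *v (P *v x)" for x
    by (simp add: A matrix_vector_mul_assoc)
  have AB: "A *v (- (Y *v q)) + B *v q = s *\<^sub>R (V *v (Y *v q))" for q
    by (simp add: A_vec B vec.neg matrix_vector_right_distrib matrix_vector_mult_scaleR)
  have U: "s *\<^sub>R (U *v q) = C *v (- (Y *v q)) + D *v q" for q
    using s by (simp add: U_def matrix_vector_mult_diff_rdistrib matrix_vector_mul_assoc vec.neg
        flip: scaleR_matrix_vector_assoc)

  have U_inner: "(U *v q) \<bullet> (U *v q') = q \<bullet> q'" for q q'
  proof -
    have "(s *\<^sub>R (V *v (Y *v q))) \<bullet> (s *\<^sub>R (V *v (Y *v q'))) + (s *\<^sub>R (U *v q)) \<bullet> (s *\<^sub>R (U *v q'))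
        = N * ((Y *v q) \<bullet> (Y *v q') + q \<bullet> q')"
      using gram[of "- (Y *v q)" q "- (Y *v q')" q'] by (simp add: AB U)
    then have "N * ((U *v q) \<bullet> (U *v q')) = N * (q \<bullet> q')"
      by (simp add: V_inner algebra_simps flip: s(2))
    then show ?thesis using \<open>N > 0\<close> by simp
  qed
  then have U_orth: "orthogonal_matrix U" by (rule orthogonal_matrixI_inner)
  \<comment> \<open>\<open>U\<^sup>T D\<close> as a bilinear form; its symmetry is read off from the right-hand side.\<close>
  have UD: "s * ((U *v q) \<bullet> (D *v q')) = N * (q \<bullet> q') - N * ((Y *v q) \<bullet> (Y *v q'))
      - s * ((Y *v q) \<bullet> (P *v (Y *v q')))" for q q'
  proof -
    have "(s *\<^sub>R (V *v (Y *v q))) \<bullet> (B *v q') + (s *\<^sub>R (U *v q)) \<bullet> (D *v q') = N * (q \<bullet> q')"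
      using gram[of "- (Y *v q)" q 0 q'] by (simp add: AB U)
    then show ?thesis
      by (simp add: B V_inner inner_add_right algebra_simps flip: s(2))
  qed
  have sym: "(U *v q) \<bullet> (D *v q') = (U *v q') \<bullet> (D *v q)" for q q'
  proof -
    have "s * ((U *v q) \<bullet> (D *v q')) = s * ((U *v q') \<bullet> (D *v q))"
      unfolding UD using P_inner[of "Y *v q" "Y *v q'"] by (simp add: inner_commute)
    then show ?thesis using s by simp
  qed
  \<comment> \<open>Comparing \<open>|B q|\<^sup>2 \<le> N |q|\<^sup>2\<close> with this expansion leaves \<open>U\<^sup>T D\<close> a nonnegative rest.\<close>
  have B_inner: "(B *v q) \<bullet> (B *v q) = N * ((Y *v q) \<bullet> (Y *v q))
      + 2 * s * ((Y *v q) \<bullet> (P *v (Y *v q))) + (P *v (Y *v q)) \<bullet> (P *v (Y *v q))" for q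
    unfolding B V_inner by (simp add: P_inner inner_simps algebra_simps flip: s(2))
  have psd: "0 \<le> (U *v q) \<bullet> (D *v q)" for q
  proof -
    have "(B *v q) \<bullet> (B *v q) + (D *v q) \<bullet> (D *v q) = N * (q \<bullet> q)"
      using gram[of 0 q 0 q] by simp
    moreover have "0 \<le> s * ((Y *v q) \<bullet> (P *v (Y *v q)))"
      using s(1) P_nonneg by simp
    ultimately have "0 \<le> s * ((U *v q) \<bullet> (D *v q))"
      unfolding UD using B_inner[of q] inner_ge_zero[of "D *v q"]
        inner_ge_zero[of "P *v (Y *v q)"] by linarith
    then show ?thesis using s(1) by (simp add: zero_le_mult_iff)
  qed

  have "sign_matrix (block_matrix A B C D)" using H by (simp add: hadamard_def)
  note signs = sign_matrix_blocks[OF this]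
  let ?r = "real CARD('r)"
  \<comment> \<open>\<open>K \<ge> s + m\<close> controls \<open>Y\<close>, as \<open>B = V K Y\<close> and \<open>V\<close> preserves lengths.\<close>
  have Y_norm: "(s + m) * norm (Y *v q) \<le> norm (B *v q)" for q
  proof (cases "Y *v q = 0")
    case False
    let ?y = "Y *v q"
    have "(s + m) * (norm ?y * norm ?y) \<le> ?y \<bullet> (s *\<^sub>R ?y + P *v ?y)"
      using m(2)[of ?y] by (simp add: inner_simps algebra_simps flip: power2_eq_square power2_norm_eq_inner)
    also have "\<dots> \<le> norm ?y * norm (s *\<^sub>R ?y + P *v ?y)" by (rule norm_cauchy_schwarz)
    also have "norm (s *\<^sub>R ?y + P *v ?y) = norm (B *v q)"
      by (simp add: B norm_eq_sqrt_inner V_inner)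
    finally show ?thesis using False by simp
  qed simp
  have small: "\<bar>(C ** Y) $ i $ j\<bar> < 1" for i j
  proof -
    have C_norm: "norm (C $ i) = sqrt ?r"
      using signs(3) by (intro norm_sign_vec) (auto simp: sign_matrix_def)
    have "norm (B *v axis j 1) = sqrt ?r"
      using signs(2) by (intro norm_sign_vec)
        (auto simp: sign_matrix_def matrix_vector_mult_basis column_def)
    then have "(s + m) * norm (Y *v axis j 1) \<le> sqrt ?r"
      using Y_norm[of "axis j 1"] by simp
    have "(C ** Y) $ i $ j = C $ i \<bullet> (Y *v axis j 1)"
      by (simp add: matrix_matrix_mult_def inner_vec_def matrix_vector_mult_basis column_def)
    then have "\<bar>(C ** Y) $ i $ j\<bar> \<le> norm (C $ i) * norm (Y *v axis j 1)"
      using Cauchy_Schwarz_ineq2 by metis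
    then have "(s + m) * \<bar>(C ** Y) $ i $ j\<bar> \<le> sqrt ?r * ((s + m) * norm (Y *v axis j 1))"
      using C_norm s(1) m(1) by (simp add: mult.left_commute mult_left_mono)
    also have "\<dots> \<le> sqrt ?r * sqrt ?r"
      using \<open>(s + m) * norm (Y *v axis j 1) \<le> sqrt ?r\<close> by (intro mult_left_mono) auto
    also have "\<dots> < (s + m) * 1"
      using bound by (simp add: s_def N_def)
    finally show ?thesis using s(1) m(1) by (simp add: mult_less_cancel_left)
  qed
  have "sgn (U $ i $ j) = D $ i $ j" for i j
  proof -
    have "U $ i $ j = (D $ i $ j - (C ** Y) $ i $ j) / s"
      by (simp add: U_def)
    moreover have "sgn (D $ i $ j - (C ** Y) $ i $ j) = D $ i $ j"
      using signs(4)[unfolded sign_matrix_def, rule_format, of i j] small[of i j]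
      by (auto simp: sgn_if abs_if split: if_splits)
    ultimately show ?thesis
      using s(1) by (simp add: divide_inverse sgn_mult)
  qed
  then show ?thesis
    using almost_hadamard_patternI[OF U_orth signs(4)] sym psd by blast
qed

section \<open>Sign matrices of small order\<close>

lemma invertible_columns_independent:
  fixes A :: "real^'n^'n"
  assumes "invertible A" and "i \<noteq> j"
  shows "\<not> (\<forall>k. A $ k $ i = c * A $ k $ j)"
proof
  assume "\<forall>k. A $ k $ i = c * A $ k $ j"
  then have "A *v (axis i 1 - c *\<^sub>R axis j 1) = 0"
    by (simp add: matrix_vector_mult_diff_distrib matrix_vector_mult_scaleR
        matrix_vector_mult_basis column_def vec_eq_iff)
  then have "axis i 1 - c *\<^sub>R axis j 1 = (0 :: real^'n)"
    using assms(1) by (metis invertible_left_inverse matrix_left_invertible_ker)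
  then have "(axis i 1 - c *\<^sub>R axis j 1 :: real^'n) $ i = 0" by simp
  with assms(2) show False by (simp add: axis_def)
qed

lemma invertible_sign_columns:
  fixes A :: "real^'n^'n"
  assumes "invertible A" and A: "sign_matrix A" and "i \<noteq> j"
  shows "\<not> (\<forall>k. A $ k $ i * A $ k $ j = c)"
proof
  assume *: "\<forall>k. A $ k $ i * A $ k $ j = c"
  have "A $ k $ i = c * A $ k $ j" for k
    using *[rule_format, of k] A[unfolded sign_matrix_def, rule_format, of k j] by auto
  with invertible_columns_independent[OF assms(1,3)] show False by blast
qed

lemma gram_nth: "(transpose A ** A) $ i $ j = (\<Sum>k\<in>UNIV. A $ k $ i * A $ k $ j)"
  by (simp add: matrix_matrix_mult_def transpose_def)

lemma sign_sq:
  assumes "sign_matrix A"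
  shows "A $ i $ j * A $ i $ j = 1"
  using assms[unfolded sign_matrix_def, rule_format, of i j] by auto

lemma gram_diag:
  fixes A :: "real^'n^'m"
  assumes "sign_matrix A"
  shows "(transpose A ** A) $ i $ i = real CARD('m)"
  by (simp add: gram_nth sign_sq[OF assms])

text \<open>Two sign vectors of length 2 are orthogonal unless they are proportional.\<close>
lemma gram_small:
  fixes A :: "real^'n^'n"
  assumes A: "sign_matrix A" and "CARD('n) = 1 \<or> invertible A \<and> CARD('n) = 2"
  shows "transpose A ** A = real CARD('n) *\<^sub>R mat 1"
proof -
  have "(transpose A ** A) $ i $ j = 0" if "i \<noteq> j" for i j
  proof -
    have "CARD('n) \<noteq> 1"
      using that by (metis card_1_singletonE UNIV_I singletonD)
    with assms(2) have inv: "invertible A" and "card (UNIV :: 'n set) = 2" by auto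
    then obtain a b :: 'n where ab: "UNIV = {a, b}" "a \<noteq> b" by (auto simp: card_2_iff)
    have pm: "A $ k $ i * A $ k $ j \<in> {-1, 1}" for k
      using A[unfolded sign_matrix_def, rule_format, of k i]
        A[unfolded sign_matrix_def, rule_format, of k j] by auto
    have "A $ a $ i * A $ a $ j \<noteq> A $ b $ i * A $ b $ j"
      using invertible_sign_columns[OF inv A that, of "A $ b $ i * A $ b $ j"] ab(1)
      by (metis UNIV_I insertE singletonD)
    with pm[of a] pm[of b] show ?thesis
      using ab(2) by (auto simp: gram_nth ab(1))
  qed
  then show ?thesis
    using gram_diag[OF A] by (auto simp: vec_eq_iff mat_def)
qed

text \<open>A nonconstant sign vector of length 3 has the form \<open>x = a (1 - 2 e\<^sub>p)\<close> with a sign \<open>a\<close> and a unit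
  vector \<open>e\<^sub>p\<close>, and its sum is \<open>a\<close>. If \<open>y = b (1 - 2 e\<^sub>q)\<close>, then the entrywise product is constant for
  \<open>p = q\<close>, and for \<open>p \<noteq> q\<close> it is \<open>a b (1 - 2 e\<^sub>p - 2 e\<^sub>q)\<close>, with sum \<open>- a b\<close>.\<close>
lemma sign_triple_sums:
  fixes x1 x2 x3 y1 y2 y3 :: real
  assumes "x1 \<in> {-1, 1}" "x2 \<in> {-1, 1}" "x3 \<in> {-1, 1}" "y1 \<in> {-1, 1}" "y2 \<in> {-1, 1}" "y3 \<in> {-1, 1}"
    and "\<not> (x1 = x2 \<and> x2 = x3)" "\<not> (y1 = y2 \<and> y2 = y3)"
    and "\<not> (x1 * y1 = x2 * y2 \<and> x2 * y2 = x3 * y3)"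
  shows "(x1 + x2 + x3) * (y1 + y2 + y3) = - (x1 * y1 + x2 * y2 + x3 * y3)"
    and "(x1 + x2 + x3) * (x1 + x2 + x3) = 1"
proof -
  have x: "x1 = 1 \<or> x1 = -1" "x2 = 1 \<or> x2 = -1" "x3 = 1 \<or> x3 = -1"
    and y: "y1 = 1 \<or> y1 = -1" "y2 = 1 \<or> y2 = -1" "y3 = 1 \<or> y3 = -1"
    using assms(1-6) by auto
  show "(x1 + x2 + x3) * (y1 + y2 + y3) = - (x1 * y1 + x2 * y2 + x3 * y3)"
    using assms(7-9) x y by (elim disjE) simp_all
  show "(x1 + x2 + x3) * (x1 + x2 + x3) = 1"
    using assms(7) x by (elim disjE) simp_all
qed

text \<open>This says \<open>(G - 1) (G - 4) = 0\<close>. The columns are pairwise nonproportional, so the entries of \<open>G\<close> off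
  the diagonal are signs; the identity holds because their product over the three pairs of columns
  is \<open>-1\<close>, as shown by \<open>sign_triple_sums\<close> with \<open>x\<close>, \<open>y\<close> the entrywise products of columns.\<close>
lemma gram_order_3:
  fixes A :: "real^'n^'n"
  assumes A: "sign_matrix A" and inv: "invertible A" and "CARD('n) = 3"
  defines "G \<equiv> transpose A ** A"
  shows "G ** G = 5 *\<^sub>R G - 4 *\<^sub>R mat 1"
proof -
  obtain a b c :: 'n where abc: "UNIV = {a, b, c}" "a \<noteq> b" "b \<noteq> c" "a \<noteq> c"
    using assms(3) by (auto simp: card_3_iff)
  have G: "G $ i $ j = A $ a $ i * A $ a $ j + A $ b $ i * A $ b $ j + A $ c $ i * A $ c $ j" for i j
    using abc(2-4) by (simp add: G_def gram_nth abc(1) add.assoc)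
  have pm: "A $ k $ i * A $ k $ j \<in> {-1, 1}" for k i j
    using A[unfolded sign_matrix_def, rule_format, of k i]
      A[unfolded sign_matrix_def, rule_format, of k j] by auto
  have all3: "(\<forall>k. Q k) \<longleftrightarrow> Q a \<and> Q b \<and> Q c" for Q
    using abc(1) by (metis UNIV_I insertE singletonD)
  have nonconst: "\<not> (A $ a $ i * A $ a $ j = A $ b $ i * A $ b $ j \<and>
      A $ b $ i * A $ b $ j = A $ c $ i * A $ c $ j)" if "i \<noteq> j" for i j
    using invertible_sign_columns[OF inv A that, of "A $ c $ i * A $ c $ j"] by (auto simp: all3)
  have cancel: "(A $ k $ i * A $ k $ l) * (A $ k $ l * A $ k $ j) = A $ k $ i * A $ k $ j" for k i j l
    using sign_sq[OF A, of k l] by (simp add: mult.assoc mult.left_commute)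
  have off: "G $ i $ l * G $ l $ j = - G $ i $ j" "G $ i $ l * G $ i $ l = 1"
    if "i \<noteq> l" "l \<noteq> j" "i \<noteq> j" for i j l
    using sign_triple_sums[OF pm pm pm pm pm pm nonconst[OF that(1)] nonconst[OF that(2)]]
      nonconst[OF that(3)] unfolding G cancel by blast+
  have diag: "G $ i $ i = 3" for i
    using gram_diag[OF A] assms(3) by (simp add: G_def)
  have G_sym: "G $ i $ j = G $ j $ i" for i j
    by (simp add: G_def gram_nth mult.commute)
  have "(G ** G) $ i $ j = 5 * G $ i $ j - 4 * (if i = j then 1 else 0)" for i j
  proof -
    obtain k l where kl: "UNIV = {i, k, l}" "i \<noteq> k" "k \<noteq> l" "i \<noteq> l" "i = j \<or> k = j"
    proof (cases "i = j")
      case True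
      have "card (UNIV - {i}) = 2" using assms(3) by simp
      then obtain k l where "UNIV - {i} = {k, l}" "k \<noteq> l" unfolding card_2_iff by blast
      with True show thesis by (intro that[of k l]) auto
    next
      case False
      have "card (UNIV - {i, j}) = 1" using assms(3) False by (simp add: card_Diff_subset)
      then obtain l where "UNIV - {i, j} = {l}" by (rule card_1_singletonE)
      with False show thesis by (intro that[of j l]) auto
    qed
    have GG: "(G ** G) $ i $ j = G $ i $ i * G $ i $ j + G $ i $ k * G $ k $ j + G $ i $ l * G $ l $ j"
      using kl(2-4) by (simp add: matrix_matrix_mult_def kl(1) add.assoc)
    show ?thesis
    proof (cases "i = j")
      case True
      then show ?thesis
        using GG off(2)[of i k l] off(2)[of i l k] kl(2-4) diag G_sym[of k i] G_sym[of l i] by simp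
    next
      case False
      then have "k = j" using kl(5) by simp
      then show ?thesis
        using GG off(1)[of i l j] kl(2-4) diag by simp
    qed
  qed
  then show ?thesis by (simp add: vec_eq_iff mat_def)
qed

text \<open>On the eigenvalues 1 and 4 of \<open>G = A\<^sup>T A\<close> the square root agrees with \<open>(G + 2) / 3\<close>, and the inverse
  square root with \<open>(7 - G) / 6\<close>.\<close>
lemma polar_form_order_3:
  fixes A :: "real^'n^'n"
  assumes A: "sign_matrix A" and inv: "invertible A" and "CARD('n) = 3"
  obtains V P where "orthogonal_matrix V" "A = V ** P" "transpose P = P"
    "\<And>x. 1 * (x \<bullet> x) \<le> x \<bullet> (P *v x)"
proof
  define G where "G = transpose A ** A"
  let ?V = "(1/6) *\<^sub>R (A ** (7 *\<^sub>R mat 1 - G))"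
  let ?P = "(1/3) *\<^sub>R (G + 2 *\<^sub>R mat 1)"
  have G_trans: "transpose G = G" by (simp add: G_def matrix_transpose_mul)
  have GG: "G *v (G *v x) = 5 *\<^sub>R (G *v x) - 4 *\<^sub>R x" for x
    unfolding matrix_vector_mul_assoc gram_order_3[OF A inv assms(3), folded G_def]
    by (simp add: matrix_vector_mult_diff_rdistrib flip: scaleR_matrix_vector_assoc)
  have V: "?V *v x = (1/6) *\<^sub>R (A *v (7 *\<^sub>R x - G *v x))" for x
    by (simp add: matrix_vector_mult_diff_rdistrib flip: scaleR_matrix_vector_assoc matrix_vector_mul_assoc)
  have P: "?P *v x = (1/3) *\<^sub>R (G *v x + 2 *\<^sub>R x)" for x
    by (simp add: matrix_vector_mult_add_rdistrib flip: scaleR_matrix_vector_assoc)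
  have AA: "(A *v x) \<bullet> (A *v y) = x \<bullet> (G *v y)" for x y
    by (simp add: G_def inner_matrix_vector_mult matrix_vector_mul_assoc del: transpose_matrix_vector)
  have G_inner: "(G *v x) \<bullet> y = x \<bullet> (G *v y)" for x y
    using inner_matrix_vector_mult[of G x y] by (simp add: G_trans)
  have "(?V *v x) \<bullet> (?V *v y) = x \<bullet> y" for x y
    unfolding V by (simp add: AA GG G_inner matrix_vector_mult_diff_distrib
        matrix_vector_mult_scaleR inner_simps algebra_simps)
  then show "orthogonal_matrix ?V" by (rule orthogonal_matrixI_inner)
  have "?V *v (?P *v x) = A *v x" for x
    unfolding V P by (simp add: GG matrix_vector_right_distrib
        matrix_vector_mult_scaleR algebra_simps flip: scaleR_add_left)
  then show "A = ?V ** ?P"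
    by (simp add: matrix_eq flip: matrix_vector_mul_assoc)
  show "transpose ?P = ?P"
    using G_trans by (simp add: transpose_def vec_eq_iff mat_def)
  show "1 * (x \<bullet> x) \<le> x \<bullet> (?P *v x)" for x
  proof -
    \<comment> \<open>\<open>G - 1 = (G - 1)\<^sup>2 / 3\<close> is a square, hence \<open>G \<ge> 1\<close>.\<close>
    have "(G *v x - x) \<bullet> (G *v x - x) = 3 * (x \<bullet> (G *v x) - x \<bullet> x)"
      by (simp add: G_inner GG inner_simps)
    then have "0 \<le> 3 * (x \<bullet> (G *v x) - x \<bullet> x)" by (metis inner_ge_zero)
    then show ?thesis unfolding P by (simp add: inner_simps)
  qed
qed

lemma polar_form_scaled_orthogonal:
  fixes A :: "real^'n^'n"
  assumes A: "transpose A ** A = real CARD('n) *\<^sub>R mat 1"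
  obtains V P where "orthogonal_matrix V" "A = V ** P" "transpose P = P"
    "\<And>x. sqrt (real CARD('n)) * (x \<bullet> x) \<le> x \<bullet> (P *v x)"
proof
  let ?s = "sqrt (real CARD('n))"
  show "orthogonal_matrix ((1 / ?s) *\<^sub>R A)"
    by (simp add: orthogonal_matrix transpose_scalar matrix_scalar_ac A flip: scalar_matrix_assoc)
  show "A = ((1 / ?s) *\<^sub>R A) ** (?s *\<^sub>R mat 1)"
    by (simp add: matrix_scalar_ac flip: scalar_matrix_assoc)
  show "transpose (?s *\<^sub>R mat 1 :: real^'n^'n) = ?s *\<^sub>R mat 1"
    by (simp add: transpose_scalar)
  show "?s * (x \<bullet> x) \<le> x \<bullet> ((?s *\<^sub>R mat 1) *v x)" for x :: "real^'n"
    by (simp flip: scaleR_matrix_vector_assoc)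
qed

lemma almost_hadamard_pattern_order_1:
  fixes D :: "real^'n^'n"
  assumes D: "sign_matrix D" and "CARD('n) = 1"
  shows "almost_hadamard_pattern D"
proof (rule almost_hadamard_patternI)
  show "orthogonal_matrix D"
    using gram_small[OF D] assms(2) by (simp add: orthogonal_matrix)
  show "sgn (D $ i $ j) = D $ i $ j" for i j
    using D[unfolded sign_matrix_def, rule_format, of i j] by auto
qed (simp_all add: D inner_commute)

section \<open>Complements of small blocks\<close>

theorem mainTheorem1:
  fixes A :: "real^'r^'r" and B :: "real^'d^'r" and C :: "real^'r^'d" and D :: "real^'d^'d"
    and r d N :: nat
  assumes "r = CARD('r)" and "d = CARD('d)" and "N = r + d"
    and "hadamard (block_matrix A B C D)"
    and "(invertible A \<and> r \<in> {1, 2, 3})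
       \<or> (hadamard A \<and> real N > real r * (real r - 1)\<^sup>2)
       \<or> (invertible A \<and> real N > (real r)\<^sup>2 / 4 * (real r + sqrt ((real r)\<^sup>2 + 8))\<^sup>2)"
  shows "almost_hadamard_pattern D"
proof -
  have N: "real N = real (CARD('r) + CARD('d))" using assms(1-3) by simp
  have r1: "r \<ge> 1" and d1: "d \<ge> 1"
    using assms(1,2) by (simp_all add: Suc_leI)
  have "sign_matrix (block_matrix A B C D)" using assms(4) by (simp add: hadamard_def)
  then have A: "sign_matrix A" and D: "sign_matrix D" by (rule sign_matrix_blocks)+
  have pattern: "almost_hadamard_pattern D"
    if "orthogonal_matrix V" "A = V ** P" "transpose P = P" "0 \<le> m"
      "\<And>x. m * (x \<bullet> x) \<le> x \<bullet> (P *v x)" "real r < sqrt (real N) + m" for V P m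
    using hadamard_complement_pattern[OF assms(4) that(1-5)] that(6) N assms(1) by simp
  have scaled: "almost_hadamard_pattern D"
    if "transpose A ** A = real CARD('r) *\<^sub>R mat 1" "real r < sqrt (real N) + sqrt (real r)"
    using polar_form_scaled_orthogonal[OF that(1)] pattern[where m = "sqrt (real r)"] that(2) assms(1)
    by (metis real_sqrt_ge_zero of_nat_0_le_iff)
  from assms(5) consider "invertible A" "r = 1 \<or> r = 2" | "invertible A" "r = 3"
    | "hadamard A" "real N > real r * (real r - 1)\<^sup>2"
    | "real N > (real r)\<^sup>2 / 4 * (real r + sqrt ((real r)\<^sup>2 + 8))\<^sup>2"
    by auto
  then show ?thesis
  proof cases
    case 1
    have "real r < sqrt (real N) + sqrt (real r)"
      using 1(2)
    proof
      assume "r = 1"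
      with assms(3) d1 show ?thesis by simp
    next
      assume "r = 2"
      then have "1 < sqrt (real N)" "1 < sqrt (real r)" "real r = 2"
        using assms(3) by auto
      then show ?thesis by linarith
    qed
    with scaled gram_small[OF A] 1 assms(1) show ?thesis by auto
  next
    case 2
    show ?thesis
    proof (cases "d = 1")
      case True
      with almost_hadamard_pattern_order_1[OF D] assms(2) show ?thesis by simp
    next
      case False
      with d1 assms(3) 2 have "real N > 2\<^sup>2" by simp
      then have "2 < sqrt (real N)" by (rule real_less_rsqrt)
      with 2 have "real r < sqrt (real N) + 1" by simp
      moreover obtain V P where "orthogonal_matrix V" "A = V ** P" "transpose P = P"
        "\<And>x. 1 * (x \<bullet> x) \<le> x \<bullet> (P *v x)"
        using polar_form_order_3[OF A 2(1)] 2(2) assms(1) by metis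
      ultimately show ?thesis using pattern[of V P 1] by simp
    qed
  next
    case 3
    let ?q = "sqrt (real r)"
    have q: "1 \<le> ?q" "?q * ?q = real r" using r1 by simp_all
    \<comment> \<open>The hypothesis even gives \<open>r sqrt r < sqrt N + sqrt r\<close>.\<close>
    have "(?q * (real r - 1))\<^sup>2 < real N"
      using 3(2) by (simp add: power_mult_distrib)
    then have "?q * (real r - 1) < sqrt (real N)" by (rule real_less_rsqrt)
    then have "?q * real r < sqrt (real N) + ?q" by (simp add: algebra_simps)
    moreover have "1 * real r \<le> ?q * real r" using q(1) by (intro mult_right_mono) auto
    ultimately have "real r < sqrt (real N) + ?q" by linarith
    with scaled hadamard_gram[OF 3(1)] show ?thesis by blast
  next
    case 4
    \<comment> \<open>The second factor is at least 4, so the hypothesis implies \<open>N > r\<^sup>2\<close>.\<close>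
    have "0 \<le> sqrt ((real r)\<^sup>2 + 8)" "3 \<le> sqrt ((real r)\<^sup>2 + 8)"
      using r1 by (auto intro!: real_le_rsqrt)
    then have "2\<^sup>2 \<le> (real r + sqrt ((real r)\<^sup>2 + 8))\<^sup>2"
      by (intro power_mono) auto
    then have "(real r)\<^sup>2 / 4 * 4 \<le> (real r)\<^sup>2 / 4 * (real r + sqrt ((real r)\<^sup>2 + 8))\<^sup>2"
      by (intro mult_left_mono) auto
    with 4 have "(real r)\<^sup>2 < real N" by linarith
    from real_less_rsqrt[OF this] have "real r < sqrt (real N) + 0" by simp
    moreover obtain V where V: "orthogonal_matrix V" "transpose (transpose V ** A) = transpose V ** A"
      "\<And>x. 0 \<le> x \<bullet> (transpose V ** A *v x)"
      using polar_decomposition[of A] by blast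
    moreover have "A = V ** (transpose V ** A)"
      using V(1) by (simp add: matrix_mul_assoc orthogonal_matrix_def)
    ultimately show ?thesis using pattern[of V "transpose V ** A" 0] by simp
  qed
qed

end
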